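(* Let $m,n,g$ be positive integers with $n>m(g-1)$, and let $\mathrm{Thin}_{m,n,g}$ be the subcomplex of $TF_{m,n,g}$ consisting of all thin flips. Then $\mathrm{Thin}_{m,n,g}$ consists of $M:=(m+n)/\gcd(m,n)$ cubes (together with their faces), each of dimension $\gcd(m,n)$, which are connected together by their diagonally opposite end vertices, like a garland, to form one cycle. That is, the maximal cubes can be numbered $Q_i$, $i\in\mathbb Z/M$, so that there are distinct vertices $v_i$, $i\in\mathbb Z/M$, with $v_i$ and $v_{i+1}$ diagonally opposite in $Q_i$ and $Q_i\cap Q_j=\{v_i,v_{i+1}\}\cap\{v_j,v_{j+1}\}$ for all $i\ne j$.
   Context: Torus fronts. Let $N=(0,1)$ (northbound step) and $E=(1,0)$ (eastbound step). Consider bi-infinite lattice paths in $\mathbb Z^2$ with steps $N$ and $E$, meeting each line $x+y=k$ ($k\in\mathbb Z$) in one vertex, and invariant under translation by $(n,m)$, so that each period has $m$ northbound and $n$ eastbound steps. An $(m,n)$-torus front is an equivalence class of such paths under translation by $(-1,1)$. Equivalently, it is a word $(s_i)_{i\in\mathbb Z/(m+n)}$ with $m$ letters $N$ and $n$ letters $E$, where $s_i$ is the step from the line $x+y=i-1$ to the line $x+y=i$. A sharp corner at position $i$ is a vertex with $s_i\ne s_{i+1}$. The elementary flip at $i$ interchanges $(s_i,s_{i+1})=(N,E)$ and $(E,N)$. Flips. A flip is given by a torus front and a set $I$ of positions of sharp corners, any two distinct elements of $I$ being at cyclic distance at least $2$ in $\mathbb Z/(m+n)$, where the orientation ($NE$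 or $EN$) at each $i\in I$ is regarded as undetermined. Its members are the $2^{|I|}$ torus fronts obtained by choosing an orientation at each $i\in I$. (Flips at different positions are different, also when $m+n=2$.) The complex $TF_{m,n,g}$. Its vertices are the $(m,n)$-torus fronts all of whose horizontal legs have length at least $g$. That is, between any two cyclically consecutive northbound steps there are at least $g-1$ eastbound steps; the length of a leg is its number of vertices, and legs of length $1$ count. Its cubes are the flips all of whose members are vertices of $TF_{m,n,g}$. The flip with set $I$ is a cube of dimension $|I|$, whose faces are obtained by fixing the orientation at some positions in $I$. Width. For a torus front $T$, represented by a periodic path, consider the two lines of slope $m/n$ that are tangent to the path from the northwest and from the southeast. The width $w(T)$ is the distance between these lines measured along the line $x=-y$. Equivalently, $w(T)=\frac{\sqrt2}{m+n}(\max f-\min f)$, where $f(x,y)=ny-mx$ is evaluated on the vertices of the path. The width $w(F)$ of a flip $F$ is the maximum of the widths of its members. A flip (or torus front) is thin if its width is at most $\sqrt2$. *)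

theory Defs
  imports "HOL-Analysis.Analysis"
begin

section \<open>Periodic lattice paths and torus fronts\<close>

datatype step = North | East

fun step_vec :: "step \<Rightarrow> int \<times> int" where
  "step_vec North = (0, 1)"
| "step_vec East = (1, 0)"

text \<open>
  A torus front is encoded as a bi-infinite \<open>(m + n)\<close>-periodic word; \<open>T i\<close> is the step from the
  line \<open>x + y = i - 1\<close> to the line \<open>x + y = i\<close>.
\<close>

definition torus_fronts :: "nat \<Rightarrow> nat \<Rightarrow> (int \<Rightarrow> step) set" where
  "torus_fronts m n =
     {T. (\<forall>i. T (i + int (m + n)) = T i) \<and>
         card {i \<in> {0..<int (m + n)}. T i = North} = m \<and>
         card {i \<in> {0..<int (m + n)}. T i = East} = n}"

text \<open>A path is given by its vertices, \<open>p k\<close> being the vertex on the line \<open>x + y = k\<close>.\<close>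

definition periodic_path :: "nat \<Rightarrow> nat \<Rightarrow> (int \<Rightarrow> int \<times> int) \<Rightarrow> bool" where
  "periodic_path m n p \<longleftrightarrow>
     (\<forall>k. fst (p k) + snd (p k) = k) \<and>
     (\<forall>k. p k - p (k - 1) \<in> range step_vec) \<and>
     (\<forall>k. p (k + int (m + n)) = p k + (int n, int m))"

definition path_word :: "(int \<Rightarrow> int \<times> int) \<Rightarrow> int \<Rightarrow> step" where
  "path_word p k = (THE s. p k - p (k - 1) = step_vec s)"

text \<open>The representative of a torus front passing through the origin.\<close>

definition front_path :: "(int \<Rightarrow> step) \<Rightarrow> int \<Rightarrow> int \<times> int" where
  "front_path T k = (\<Sum>i\<in>{0<..k}. step_vec (T i)) - (\<Sum>i\<in>{k<..0}. step_vec (T i))"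

section \<open>Width\<close>

definition slope_line :: "nat \<Rightarrow> nat \<Rightarrow> real \<Rightarrow> (real \<times> real) set" where
  "slope_line m n b = {(x, y). y = real m / real n * x + b}"

definition path_points :: "(int \<Rightarrow> int \<times> int) \<Rightarrow> (real \<times> real) set" where
  "path_points p = (\<lambda>(x, y). (real_of_int x, real_of_int y)) ` range p"

definition nw_tangent :: "nat \<Rightarrow> nat \<Rightarrow> (int \<Rightarrow> int \<times> int) \<Rightarrow> (real \<times> real) set \<Rightarrow> bool" where
  "nw_tangent m n p l \<longleftrightarrow>
     (\<exists>b. l = slope_line m n b \<and> l \<inter> path_points p \<noteq> {} \<and>
          (\<forall>(x, y) \<in> path_points p. y \<le> real m / real n * x + b))"

definition se_tangent :: "nat \<Rightarrow> nat \<Rightarrow> (int \<Rightarrow> int \<times> int) \<Rightarrow> (real \<times> real) set \<Rightarrow> bool" where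
  "se_tangent m n p l \<longleftrightarrow>
     (\<exists>b. l = slope_line m n b \<and> l \<inter> path_points p \<noteq> {} \<and>
          (\<forall>(x, y) \<in> path_points p. y \<ge> real m / real n * x + b))"

definition path_width :: "nat \<Rightarrow> nat \<Rightarrow> (int \<Rightarrow> int \<times> int) \<Rightarrow> real" where
  "path_width m n p =
     (THE w. \<exists>l l' z z'. nw_tangent m n p l \<and> se_tangent m n p l' \<and>
        z \<in> l \<inter> {(x, y). x = - y} \<and> z' \<in> l' \<inter> {(x, y). x = - y} \<and> w = dist z z')"

definition width :: "nat \<Rightarrow> nat \<Rightarrow> (int \<Rightarrow> step) \<Rightarrow> real" where
  "width m n T = path_width m n (front_path T)"

section \<open>Flips\<close>

text \<open>
  Positions in \<open>\<int>/(m + n)\<close> are represented by \<open>{0..<m + n}\<close>. A flip is represented by its set of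
  positions together with its set of members. The positions cannot be omitted: for \<open>m = n = 1\<close> the
  flips at the positions \<open>0\<close> and \<open>1\<close> have the same members.
\<close>

type_synonym flip = "int set \<times> (int \<Rightarrow> step) set"

definition cyclic_dist :: "nat \<Rightarrow> int \<Rightarrow> int \<Rightarrow> int" where
  "cyclic_dist L i j = min ((i - j) mod int L) ((j - i) mod int L)"

definition flip_positions :: "nat \<Rightarrow> (int \<Rightarrow> step) \<Rightarrow> int set \<Rightarrow> bool" where
  "flip_positions L T I \<longleftrightarrow>
     I \<subseteq> {0..<int L} \<and> (\<forall>i\<in>I. T i \<noteq> T (i + 1)) \<and>
     (\<forall>i\<in>I. \<forall>j\<in>I. i \<noteq> j \<longrightarrow> cyclic_dist L i j \<ge> 2)"

text \<open>
  The members have one of the two orientations at each \<open>i \<in> I\<close> and agree with \<open>T\<close> in every step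
  that is not adjacent to a position in \<open>I\<close>.
\<close>

definition flip_members :: "nat \<Rightarrow> nat \<Rightarrow> (int \<Rightarrow> step) \<Rightarrow> int set \<Rightarrow> (int \<Rightarrow> step) set" where
  "flip_members m n T I =
     {S \<in> torus_fronts m n.
        (\<forall>i\<in>I. (S i, S (i + 1)) \<in> {(North, East), (East, North)}) \<and>
        (\<forall>k. k mod int (m + n) \<notin> I \<and> (k - 1) mod int (m + n) \<notin> I \<longrightarrow> S k = T k)}"

definition flips :: "nat \<Rightarrow> nat \<Rightarrow> flip set" where
  "flips m n =
     {(I, flip_members m n T I) | T I. T \<in> torus_fronts m n \<and> flip_positions (m + n) T I}"

definition flip_dim :: "flip \<Rightarrow> nat" where
  "flip_dim Q = card (fst Q)"

text \<open>\<open>J\<close> is the set of positions that remain undetermined; the orientation at the others is that of \<open>S\<close>.\<close>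

definition flip_faces :: "flip \<Rightarrow> flip set" where
  "flip_faces Q =
     {(J, {T \<in> snd Q. \<forall>i \<in> fst Q - J. T i = S i}) | J S. J \<subseteq> fst Q \<and> S \<in> snd Q}"

definition vertex_flip :: "(int \<Rightarrow> step) \<Rightarrow> flip" where
  "vertex_flip T = ({}, {T})"

definition diagonally_opposite :: "flip \<Rightarrow> (int \<Rightarrow> step) \<Rightarrow> (int \<Rightarrow> step) \<Rightarrow> bool" where
  "diagonally_opposite Q S T \<longleftrightarrow>
     S \<in> snd Q \<and> T \<in> snd Q \<and> (\<forall>i \<in> fst Q. S i \<noteq> T i)"

definition flip_width :: "nat \<Rightarrow> nat \<Rightarrow> flip \<Rightarrow> real" where
  "flip_width m n Q = Max (width m n ` snd Q)"

section \<open>The complexes\<close>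

text \<open>
  If \<open>T i\<close> and \<open>T j\<close> are consecutive northbound steps, then the horizontal leg between them has the
  vertices on the lines \<open>x + y = k\<close> with \<open>i \<le> k < j\<close>, and hence \<open>j - i - 1\<close> eastbound steps.
\<close>

definition legs_at_least :: "nat \<Rightarrow> (int \<Rightarrow> step) \<Rightarrow> bool" where
  "legs_at_least g T \<longleftrightarrow>
     (\<forall>i j. i < j \<and> T i = North \<and> T j = North \<and> (\<forall>k\<in>{i<..<j}. T k = East) \<longrightarrow>
        g \<le> card {i..<j})"

definition TF_vertices :: "nat \<Rightarrow> nat \<Rightarrow> nat \<Rightarrow> (int \<Rightarrow> step) set" where
  "TF_vertices m n g = {T \<in> torus_fronts m n. legs_at_least g T}"

definition TF :: "nat \<Rightarrow> nat \<Rightarrow> nat \<Rightarrow> flip set" where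
  "TF m n g = {Q \<in> flips m n. snd Q \<subseteq> TF_vertices m n g}"

definition Thin :: "nat \<Rightarrow> nat \<Rightarrow> nat \<Rightarrow> flip set" where
  "Thin m n g = {Q \<in> TF m n g. flip_width m n Q \<le> sqrt 2}"

definition maximal_cubes :: "flip set \<Rightarrow> flip set" where
  "maximal_cubes K = {Q \<in> K. \<forall>P\<in>K. Q \<in> flip_faces P \<longrightarrow> P = Q}"

section \<open>Consistency of the encodings\<close>

lemma inj_step_vec: "inj step_vec"
proof (rule injI)
  fix x y assume "step_vec x = step_vec y" then show "x = y" by (cases x; cases y) auto
qed

lemma path_word_eq: "p k - p (k - 1) = step_vec s \<Longrightarrow> path_word p k = s"
  unfolding path_word_def using inj_step_vec by (auto dest: injD)

lemma path_word_step:
  assumes "periodic_path m n p" shows "p k - p (k - 1) = step_vec (path_word p k)"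
proof -
  obtain s where "p k - p (k - 1) = step_vec s"
    using assms unfolding periodic_path_def by blast
  then show ?thesis using path_word_eq by metis
qed

lemma front_path_0: "front_path T 0 = 0"
  by (simp add: front_path_def)

lemma front_path_step: "front_path T k - front_path T (k - 1) = step_vec (T k)"
proof (cases "k \<ge> 1")
  case True
  then have "{0<..k} = insert k {0<..k-1}" "{k<..0} = {}" "{k-1<..0} = {}" by auto
  then show ?thesis by (simp add: front_path_def)
next
  case False
  then have "{k-1<..0} = insert k {k<..0}" "{0<..k} = {}" "{0<..k-1} = {}" by auto
  then show ?thesis by (simp add: front_path_def)
qed

lemma path_word_front_path: "path_word (front_path T) = T"
  by (rule ext) (intro path_word_eq front_path_step)

lemma path_sum:
  fixes p :: "int \<Rightarrow> int \<times> int"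
  assumes "\<And>k. p k - p (k - 1) = step_vec (T k)"
  shows "p (a + int l) = p a + (\<Sum>i\<in>{a<..a + int l}. step_vec (T i))"
proof (induction l)
  case (Suc l)
  have "{a<..a + int (Suc l)} = insert (a + int (Suc l)) {a<..a + int l}" by auto
  moreover have "p (a + int (Suc l)) = p (a + int l) + step_vec (T (a + int (Suc l)))"
    using assms[of "a + int (Suc l)"] by (simp add: algebra_simps)
  ultimately show ?case using Suc by (simp add: algebra_simps)
qed auto

lemma sum_step_vec:
  "finite A \<Longrightarrow> (\<Sum>i\<in>A. step_vec (T i))
     = (int (card {i\<in>A. T i = East}), int (card {i\<in>A. T i = North}))"
proof (induction A rule: finite_induct)
  case (insert x A)
  have *: "{i \<in> insert x A. T i = s} = (if T x = s then insert x {i\<in>A. T i = s} else {i\<in>A. T i = s})" for s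
    by auto
  show ?case using insert unfolding * by (cases "T x") auto
qed (simp add: zero_prod_def)

lemma path_word_torus_front:
  assumes p: "periodic_path m n p" shows "path_word p \<in> torus_fronts m n"
proof -
  let ?L = "int (m + n)" and ?T = "path_word p"
  have per: "p (k + ?L) = p k + (int n, int m)" for k
    using p unfolding periodic_path_def by blast
  have 1: "?T (i + ?L) = ?T i" for i
  proof -
    have "p (i + ?L) - p (i + ?L - 1) = p i - p (i - 1)"
      using per[of i] per[of "i - 1"] by (simp add: algebra_simps)
    then show ?thesis by (simp add: path_word_def)
  qed
  have "{-1<..-1 + ?L} = {0..<?L}" by auto
  then have "(\<Sum>i\<in>{0..<?L}. step_vec (?T i)) = (int n, int m)"
    using path_sum[of p ?T "-1" "m+n"] path_word_step[OF p] per[of "-1"] by simp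
  then show ?thesis using 1 by (simp add: torus_fronts_def sum_step_vec)
qed

lemma front_path_periodic:
  assumes T: "T \<in> torus_fronts m n" shows "periodic_path m n (front_path T)"
proof -
  let ?L = "int (m + n)" and ?p = "front_path T"
  have step: "?p k - ?p (k - 1) = step_vec (T k)" for k by (rule front_path_step)
  have per: "T (i + ?L) = T i" for i using T by (auto simp: torus_fronts_def)
  have diag: "fst (?p k) + snd (?p k) = k" for k
  proof -
    have s: "fst (?p k) + snd (?p k) = fst (?p (k-1)) + snd (?p (k-1)) + 1" for k
    proof -
      have "?p k = ?p (k-1) + step_vec (T k)" using step[of k] by (simp add: algebra_simps)
      then show ?thesis by (cases "T k") auto
    qed
    show ?thesis
    proof (induction k rule: int_induct[where k = 0])
      case base show ?case by (simp add: front_path_0)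
    next
      case (step1 i) then show ?case using s[of "i+1"] by simp
    next
      case (step2 i) then show ?case using s[of i] by simp
    qed
  qed
  have sh: "?p (k + ?L) - ?p k = ?p (k - 1 + ?L) - ?p (k - 1)" for k
    using step[of k] step[of "k + ?L"] per[of k] by (simp add: algebra_simps)
  have sh0: "?p (k + ?L) - ?p k = ?p (-1 + ?L) - ?p (-1)" for k
  proof (induction k rule: int_induct[where k = "-1"])
    case base show ?case ..
  next
    case (step1 i) then show ?case using sh[of "i+1"] by simp
  next
    case (step2 i) then show ?case using sh[of i] by simp
  qed
  have "{-1<..-1 + ?L} = {0..<?L}" by auto
  then have "?p (-1 + ?L) = ?p (-1) + (int n, int m)"
    using path_sum[of ?p T "-1" "m+n"] step T by (simp add: sum_step_vec torus_fronts_def)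
  then have "?p (k + ?L) = ?p k + (int n, int m)" for k
    using sh0[of k] by (simp add: algebra_simps)
  then show ?thesis unfolding periodic_path_def using diag step by (metis rangeI)
qed

text \<open>Torus fronts correspond to classes of paths under translation by \<open>(-1, 1)\<close>.\<close>

lemma path_word_eq_iff:
  assumes p: "periodic_path m n p" and q: "periodic_path m n q"
  shows "path_word p = path_word q \<longleftrightarrow> (\<exists>c. \<forall>k. q k = p k + (- c, c))"
proof
  assume w: "path_word p = path_word q"
  have s: "q k - p k = q (k - 1) - p (k - 1)" for k
    using path_word_step[OF p, of k] path_word_step[OF q, of k] w by (simp add: algebra_simps)
  have e: "q k - p k = q 0 - p 0" for k
  proof (induction k rule: int_induct[where k = 0])
    case base show ?case ..
  next
    case (step1 i) then show ?case using s[of "i+1"] by simp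
  next
    case (step2 i) then show ?case using s[of i] by simp
  qed
  have "fst (q 0) + snd (q 0) = 0" "fst (p 0) + snd (p 0) = 0"
    using p q unfolding periodic_path_def by blast+
  then have "q 0 - p 0 = (- snd (q 0 - p 0), snd (q 0 - p 0))"
    by (simp add: prod_eq_iff)
  then have "q k = p k + (- snd (q 0 - p 0), snd (q 0 - p 0))" for k
    using e[of k] by (metis add.commute diff_add_cancel)
  then show "\<exists>c. \<forall>k. q k = p k + (- c, c)" by blast
next
  assume "\<exists>c. \<forall>k. q k = p k + (- c, c)"
  then show "path_word p = path_word q" by (auto simp: path_word_def fun_eq_iff)
qed

lemma torus_front_determined:
  assumes S: "S \<in> torus_fronts m n" and T: "T \<in> torus_fronts m n" and "m + n > 0"
    and eq: "\<And>i. 0 \<le> i \<Longrightarrow> i < int (m + n) \<Longrightarrow> S i = T i"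
  shows "S = T"
proof
  fix i
  let ?L = "int (m + n)"
  have *: "U i = U (i mod ?L)" if U: "U \<in> torus_fronts m n" for U
  proof -
    have per: "U (j + ?L) = U j" for j using U by (auto simp: torus_fronts_def)
    have "U (j + k * ?L) = U j" for j k
    proof (induction k rule: int_induct[where k = 0])
      case (step1 k) then show ?case using per[of "j + k * ?L"] by (simp add: algebra_simps)
    next
      case (step2 k) then show ?case using per[of "j + (k - 1) * ?L"] by (simp add: algebra_simps)
    qed simp
    from this[of "i mod ?L" "i div ?L"] show ?thesis by (metis mod_mult_div_eq mult.commute)
  qed
  show "S i = T i" using *[OF S] *[OF T] eq[of "i mod ?L"] assms(3) by simp
qed

lemma finite_torus_fronts:
  assumes "m + n > 0" shows "finite (torus_fronts m n)"
proof (rule inj_on_finite)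
  let ?J = "{0..<int (m + n)}"
  show "inj_on (\<lambda>T. {i \<in> ?J. T i = North}) (torus_fronts m n)"
  proof (rule inj_onI)
    fix S T :: "int \<Rightarrow> step"
    assume S: "S \<in> torus_fronts m n" and T: "T \<in> torus_fronts m n"
      and e: "{i \<in> ?J. S i = North} = {i \<in> ?J. T i = North}"
    show "S = T"
    proof (rule torus_front_determined[OF S T assms])
      fix i assume "0 \<le> i" "i < int (m + n)"
      then have "i \<in> ?J" by simp
      then have "S i = North \<longleftrightarrow> T i = North" using e by blast
      then show "S i = T i" by (metis step.exhaust)
    qed
  qed
  show "(\<lambda>T. {i \<in> ?J. T i = North}) ` torus_fronts m n \<subseteq> Pow ?J" by blast
  show "finite (Pow ?J)" by simp
qed

text \<open>The width in terms of the linear form \<open>n * y - m * x\<close>, for an arbitrary representing path.\<close>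

lemma path_width_eq:
  assumes p: "periodic_path m n p" and n: "n > 0"
  defines "F \<equiv> range (\<lambda>k. int n * snd (p k) - int m * fst (p k))"
  shows "finite F" and "path_width m n p = sqrt 2 / real (m + n) * real_of_int (Max F - Min F)"
proof -
  let ?f = "\<lambda>k. int n * snd (p k) - int m * fst (p k)" and ?L = "int (m + n)"
  have per: "p (k + ?L) = p k + (int n, int m)" for k
    using p unfolding periodic_path_def by blast
  have fper: "?f (k + ?L) = ?f k" for k using per[of k] by (simp add: algebra_simps)
  have fper': "?f (j + k * ?L) = ?f j" for j k
  proof (induction k rule: int_induct[where k = 0])
    case (step1 k) then show ?case using fper[of "j + k * ?L"] by (simp add: algebra_simps)
  next
    case (step2 k) then show ?case using fper[of "j + (k - 1) * ?L"] by (simp add: algebra_simps)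
  qed simp
  have "F \<subseteq> ?f ` {0..<?L}"
  proof
    fix x assume "x \<in> F"
    then obtain k where "x = ?f k" unfolding F_def by blast
    also have "\<dots> = ?f (k mod ?L)"
      using fper'[of "k mod ?L" "k div ?L"] by (metis mod_mult_div_eq mult.commute)
    finally show "x \<in> ?f ` {0..<?L}" using n by simp
  qed
  then show fin: "finite F" by (rule finite_subset) simp
  have ne: "F \<noteq> {}" by (simp add: F_def)
  have pp: "path_points p = range (\<lambda>k. (real_of_int (fst (p k)), real_of_int (snd (p k))))"
    by (auto simp: path_points_def image_image case_prod_unfold)
  have on: "y = real m / real n * x + b \<longleftrightarrow> real n * y - real m * x = real n * b" for x y b
    using n by (simp add: field_simps)
  have le: "y \<le> real m / real n * x + b \<longleftrightarrow> real n * y - real m * x \<le> real n * b" for x y b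
    using n by (simp add: field_simps)
  have ge: "y \<ge> real m / real n * x + b \<longleftrightarrow> real n * y - real m * x \<ge> real n * b" for x y b
    using n by (simp add: field_simps)
  have meets: "slope_line m n b \<inter> path_points p \<noteq> {} \<longleftrightarrow> (\<exists>k. real_of_int (?f k) = real n * b)" for b
  proof -
    have "slope_line m n b \<inter> path_points p \<noteq> {} \<longleftrightarrow>
        (\<exists>k. (real_of_int (fst (p k)), real_of_int (snd (p k))) \<in> slope_line m n b)"
      unfolding pp by blast
    then show ?thesis unfolding slope_line_def mem_Collect_eq case_prod_conv on by simp
  qed
  have nw: "nw_tangent m n p l \<longleftrightarrow> l = slope_line m n (real_of_int (Max F) / real n)" for l
  proof -
    have H: "slope_line m n b \<inter> path_points p \<noteq> {} \<and>
          (\<forall>(x, y) \<in> path_points p. y \<le> real m / real n * x + b)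
        \<longleftrightarrow> b = real_of_int (Max F) / real n" (is "?A b \<longleftrightarrow> _") for b
    proof -
      have 1: "?A b \<longleftrightarrow> (\<exists>k. real_of_int (?f k) = real n * b) \<and> (\<forall>k. real_of_int (?f k) \<le> real n * b)"
        unfolding meets le unfolding pp by simp
      have 2: "real n * b = real_of_int (Max F)"
        if ex: "\<exists>k. real_of_int (?f k) = real n * b" and al: "\<forall>k. real_of_int (?f k) \<le> real n * b"
      proof -
        obtain k where k: "real_of_int (?f k) = real n * b" using ex by blast
        have "Max F = ?f k"
        proof (rule Max_eqI[OF fin])
          fix y assume "y \<in> F"
          then obtain j where y: "y = ?f j" unfolding F_def by blast
          have "real_of_int (?f j) \<le> real_of_int (?f k)" unfolding k using al by blast
          then show "y \<le> ?f k" unfolding y of_int_le_iff .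
        qed (simp add: F_def)
        then show ?thesis using k by simp
      qed
      have 3: "(\<exists>k. real_of_int (?f k) = real n * b) \<and> (\<forall>k. real_of_int (?f k) \<le> real n * b)"
        if e: "real n * b = real_of_int (Max F)"
      proof -
        have "Max F \<in> F" using fin ne by simp
        then obtain k where "?f k = Max F" unfolding F_def by fastforce
        moreover have "?f k \<le> Max F" for k using fin by (simp add: F_def)
        ultimately show ?thesis unfolding e of_int_le_iff of_int_eq_iff by blast
      qed
      have "real n * b = real_of_int (Max F) \<longleftrightarrow> b = real_of_int (Max F) / real n"
        using n by (simp add: field_simps)
      then show ?thesis using 1 2 3 by blast
    qed
    have G: "l = slope_line m n b \<and> l \<inter> path_points p \<noteq> {} \<and>
          (\<forall>(x, y) \<in> path_points p. y \<le> real m / real n * x + b)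
        \<longleftrightarrow> l = slope_line m n b \<and> b = real_of_int (Max F) / real n" for b
    proof (cases "l = slope_line m n b")
      case True
      show ?thesis unfolding True H by blast
    qed blast
    show ?thesis unfolding nw_tangent_def G by blast
  qed
  have se: "se_tangent m n p l \<longleftrightarrow> l = slope_line m n (real_of_int (Min F) / real n)" for l
  proof -
    have H: "slope_line m n b \<inter> path_points p \<noteq> {} \<and>
          (\<forall>(x, y) \<in> path_points p. y \<ge> real m / real n * x + b)
        \<longleftrightarrow> b = real_of_int (Min F) / real n" (is "?A b \<longleftrightarrow> _") for b
    proof -
      have 1: "?A b \<longleftrightarrow> (\<exists>k. real_of_int (?f k) = real n * b) \<and> (\<forall>k. real_of_int (?f k) \<ge> real n * b)"
        unfolding meets ge unfolding pp by simp
      have 2: "real n * b = real_of_int (Min F)"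
        if ex: "\<exists>k. real_of_int (?f k) = real n * b" and al: "\<forall>k. real_of_int (?f k) \<ge> real n * b"
      proof -
        obtain k where k: "real_of_int (?f k) = real n * b" using ex by blast
        have "Min F = ?f k"
        proof (rule Min_eqI[OF fin])
          fix y assume "y \<in> F"
          then obtain j where y: "y = ?f j" unfolding F_def by blast
          have "real_of_int (?f j) \<ge> real_of_int (?f k)" unfolding k using al by blast
          then show "y \<ge> ?f k" unfolding y of_int_le_iff .
        qed (simp add: F_def)
        then show ?thesis using k by simp
      qed
      have 3: "(\<exists>k. real_of_int (?f k) = real n * b) \<and> (\<forall>k. real_of_int (?f k) \<ge> real n * b)"
        if e: "real n * b = real_of_int (Min F)"
      proof -
        have "Min F \<in> F" using fin ne by simp
        then obtain k where "?f k = Min F" unfolding F_def by fastforce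
        moreover have "?f k \<ge> Min F" for k using fin by (simp add: F_def)
        ultimately show ?thesis unfolding e of_int_le_iff of_int_eq_iff by blast
      qed
      have "real n * b = real_of_int (Min F) \<longleftrightarrow> b = real_of_int (Min F) / real n"
        using n by (simp add: field_simps)
      then show ?thesis using 1 2 3 by blast
    qed
    have G: "l = slope_line m n b \<and> l \<inter> path_points p \<noteq> {} \<and>
          (\<forall>(x, y) \<in> path_points p. y \<ge> real m / real n * x + b)
        \<longleftrightarrow> l = slope_line m n b \<and> b = real_of_int (Min F) / real n" for b
    proof (cases "l = slope_line m n b")
      case True
      show ?thesis unfolding True H by blast
    qed blast
    show ?thesis unfolding se_tangent_def G by blast
  qed
  have pt: "z \<in> slope_line m n (c / real n) \<inter> {(x, y). x = - y}
      \<longleftrightarrow> z = (- (c / real (m + n)), c / real (m + n))" for z c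
  proof -
    obtain x y where z: "z = (x, y)" by fastforce
    have "real n * y - real m * (- y) = c \<longleftrightarrow> y = c / real (m + n)"
      using n by (simp add: eq_divide_eq algebra_simps)
    then have "x = - y \<and> real n * y - real m * x = c
        \<longleftrightarrow> x = - (c / real (m + n)) \<and> y = c / real (m + n)"
      by (cases "x = - y"; cases "y = c / real (m + n)") (simp_all only:, auto)
    moreover have "real n * (c / real n) = c" using n by simp
    ultimately show ?thesis unfolding z slope_line_def Int_iff mem_Collect_eq case_prod_conv on prod.inject
      by auto
  qed
  have MM: "Min F \<le> Max F" using fin ne by simp
  have d: "dist (- (a / c), a / c) (- (b / c), b / c) = sqrt 2 / c * (a - b)"
    if "c > 0" "b \<le> a" for a b c :: real
  proof -
    have "dist (- (a / c), a / c) (- (b / c), b / c) = sqrt ((a/c - b/c)\<^sup>2 + (a/c - b/c)\<^sup>2)"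
      unfolding dist_Pair_Pair dist_real_def power2_abs by (simp add: power2_eq_square algebra_simps)
    also have "\<dots> = sqrt (2 * ((a - b) / c)\<^sup>2)"
      unfolding diff_divide_distrib by simp
    also have "\<dots> = sqrt 2 / c * (a - b)" using that by (simp add: real_sqrt_mult)
    finally show ?thesis .
  qed
  have "path_width m n p = dist (- (real_of_int (Max F) / real (m + n)), real_of_int (Max F) / real (m + n))
      (- (real_of_int (Min F) / real (m + n)), real_of_int (Min F) / real (m + n))"
    unfolding path_width_def nw se by (rule the_equality) (use pt in blast, elim exE conjE, simp only: pt)
  also have "\<dots> = sqrt 2 / real (m + n) * real_of_int (Max F - Min F)"
    using d[of "real (m + n)" "real_of_int (Min F)" "real_of_int (Max F)"] MM n by simp
  finally show "path_width m n p = sqrt 2 / real (m + n) * real_of_int (Max F - Min F)" .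
qed

lemma width_representative:
  assumes p: "periodic_path m n p" and n: "n > 0"
  shows "width m n (path_word p) = path_width m n p"
proof -
  let ?f = "\<lambda>p k. int n * snd (p k) - int m * fst (p k)"
  define q where "q = front_path (path_word p)"
  have q: "periodic_path m n q"
    unfolding q_def by (intro front_path_periodic path_word_torus_front p)
  have "path_word p = path_word q" by (simp add: q_def path_word_front_path)
  then obtain c where c: "\<And>k. q k = p k + (- c, c)" using path_word_eq_iff[OF p q] by blast
  define e where "e = int (m + n) * c"
  have "?f q k = e + ?f p k" for k by (simp add: c e_def algebra_simps)
  then have r: "range (?f q) = (+) e ` range (?f p)" unfolding image_image by presburger
  have fin: "finite (range (?f p))" by (rule path_width_eq(1)[OF p n])
  have mono: "mono ((+) e)" by (simp add: mono_def)
  have "Max (range (?f q)) = e + Max (range (?f p))" "Min (range (?f q)) = e + Min (range (?f p))"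
    unfolding r by (rule mono_Max_commute[OF mono fin, symmetric] mono_Min_commute[OF mono fin, symmetric]; blast)+
  then have "path_width m n q = path_width m n p"
    unfolding path_width_eq(2)[OF p n] path_width_eq(2)[OF q n] by simp
  then show ?thesis by (simp add: width_def q_def)
qed

end

(*
  Along a path the linear form n y - m x increases by n at a northbound and decreases by m at an
  eastbound step, so at position k its value is congruent to n k modulo L = m + n; up to a constant,
  the values lie in one residue class modulo d = gcd m n. A front is thin iff the values fit into
  an interval {c..c + L}. The value is then determined by k, except at the d positions with
  n k = c modulo L, where it may be c (corner EN) or c + L (corner NE), independently of each other.
  These choices form a d-dimensional cube, and there are L / d residues c to choose from. The
  diagonally opposite fronts with only c, or only c + L, at these positions are the balanced fronts
  with values in {c..c + L - d} and {c + d..c + L}; the latter is the first end of the next cube.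
*)

theory Submission
  imports Defs
begin

section \<open>Height functions of torus fronts\<close>

lemma step_neq_trans: "(s :: step) \<noteq> t \<Longrightarrow> t \<noteq> u \<Longrightarrow> s = u"
  by (cases s; cases t; cases u) auto

lemma periodic_mod:
  fixes f :: "int \<Rightarrow> 'a"
  assumes "\<And>k. f (k + p) = f k"
  shows "f (k mod p) = f k"
proof -
  have "f (j + l * p) = f j" for j l
  proof (induction l rule: int_induct[where k = 0])
    case (step1 l) then show ?case using assms[of "j + l * p"] by (simp add: algebra_simps)
  next
    case (step2 l) then show ?case using assms[of "j + (l - 1) * p"] by (simp add: algebra_simps)
  qed simp
  from this[of "k mod p" "k div p"] show ?thesis by simp
qed

lemma const_of_step_eq:
  fixes f :: "int \<Rightarrow> 'a"
  assumes "\<And>k. f k = f (k - 1)"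
  shows "f k = f j"
proof (induction k rule: int_induct[where k = j])
  case (step1 i) then show ?case using assms[of "i + 1"] by simp
next
  case (step2 i) then show ?case using assms[of i] by simp
qed simp

locale slope =
  fixes m n :: nat
  assumes m_pos: "m > 0" and n_pos: "n > 0"
begin

abbreviation L :: int where "L \<equiv> int m + int n"

lemma L_pos: "L > 0"
  using m_pos by simp

definition rise :: "step \<Rightarrow> int" where
  "rise s = (if s = North then int n else - int m)"

lemma rise_simps [simp]: "rise North = int n" "rise East = - int m"
  by (simp_all add: rise_def)

lemma rise_inj: "rise s = rise t \<Longrightarrow> s = t"
  using m_pos n_pos by (cases s; cases t) auto

text \<open>The linear form \<open>n * y - m * x\<close> along a path, up to an additive constant.\<close>

definition height :: "(int \<Rightarrow> step) \<Rightarrow> (int \<Rightarrow> int) \<Rightarrow> bool" where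
  "height T D \<longleftrightarrow> (\<forall>k. D k - D (k - 1) = rise (T k)) \<and> (\<forall>k. D (k + L) = D k)"

lemma height_step: "height T D \<Longrightarrow> D k = D (k - 1) + rise (T k)"
  unfolding height_def by (metis diff_add_cancel add.commute)

lemma height_periodic: "height T D \<Longrightarrow> D (k + L) = D k"
  unfolding height_def by blast

lemma height_mod: "height T D \<Longrightarrow> D (k mod L) = D k"
  by (rule periodic_mod) (rule height_periodic)

text \<open>Periodicity of \<open>D\<close> makes the rises over one period cancel, so
  \<open>n * a = m * b\<close> for the numbers \<open>a\<close> of northbound and \<open>b\<close>
  of eastbound steps; with \<open>a + b = m + n\<close> this forces \<open>a = m\<close> and
  \<open>b = n\<close>.\<close>

lemma height_torus_front:
  assumes D: "height T D"
  shows "T \<in> torus_fronts m n"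
proof -
  have per: "T (i + L) = T i" for i
    using height_step[OF D, of i] height_step[OF D, of "i + L"] height_periodic[OF D, of i]
      height_periodic[OF D, of "i - 1"]
    by (intro rise_inj) (simp add: algebra_simps)
  define A where "A s = {i \<in> {0..<L}. T i = s}" for s
  have tele: "(\<Sum>i\<in>{0..<int l}. rise (T i)) = D (int l - 1) - D (-1)" for l
  proof (induction l)
    case (Suc l)
    have "{0..<int (Suc l)} = insert (int l) {0..<int l}" by auto
    then show ?case using Suc height_step[OF D, of "int l"] by simp
  qed simp
  have fin: "finite (A s)" for s unfolding A_def by (rule finite_subset[of _ "{0..<L}"]) auto
  have "T i = North \<or> T i = East" for i by (cases "T i") auto
  then have un: "{0..<L} = A North \<union> A East" and disj: "A North \<inter> A East = {}"
    unfolding A_def by auto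
  have "(\<Sum>i\<in>{0..<L}. rise (T i)) = (\<Sum>i\<in>A North. rise (T i)) + (\<Sum>i\<in>A East. rise (T i))"
    unfolding un by (rule sum.union_disjoint[OF fin fin disj])
  also have "\<dots> = int n * int (card (A North)) - int m * int (card (A East))"
    by (simp add: A_def)
  finally have "int n * int (card (A North)) = int m * int (card (A East))"
    using tele[of "m + n"] height_periodic[OF D, of "-1"] by simp
  moreover have "card (A North) + card (A East) = m + n"
    using card_Un_disjoint[OF fin fin disj] unfolding un[symmetric] by simp
  ultimately have "int n * int (card (A North)) = int m * (int m + int n - int (card (A North)))"
    by (metis add_diff_cancel_left' of_nat_add)
  then have "L * int (card (A North)) = L * int m" by (simp add: algebra_simps)
  then have "card (A North) = m" using L_pos by simp
  with \<open>card (A North) + card (A East) = m + n\<close> per show ?thesis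
    by (simp add: torus_fronts_def A_def)
qed

lemma front_height:
  assumes T: "T \<in> torus_fronts m n"
  shows "height T (\<lambda>k. int n * snd (front_path T k) - int m * fst (front_path T k))"
proof -
  have p: "front_path T (k + L) = front_path T k + (int n, int m)" for k
    using front_path_periodic[OF T] unfolding periodic_path_def by simp
  have s: "front_path T k = front_path T (k - 1) + step_vec (T k)" for k
    using front_path_step[of T k] by (simp add: algebra_simps)
  show ?thesis unfolding height_def
  proof (intro conjI allI)
    fix k
    show "int n * snd (front_path T k) - int m * fst (front_path T k)
        - (int n * snd (front_path T (k - 1)) - int m * fst (front_path T (k - 1))) = rise (T k)"
      unfolding s[of k] by (cases "T k") (simp_all add: algebra_simps)
    show "int n * snd (front_path T (k + L)) - int m * fst (front_path T (k + L))
        = int n * snd (front_path T k) - int m * fst (front_path T k)"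
      unfolding p by (simp add: algebra_simps)
  qed
qed

lemma torus_front_periodic: "T \<in> torus_fronts m n \<Longrightarrow> T (k + L) = T k"
  by (simp add: torus_fronts_def)

lemma torus_front_mod: "T \<in> torus_fronts m n \<Longrightarrow> T (k mod L) = T k"
  by (rule periodic_mod) (rule torus_front_periodic)

lemma height_unique:
  assumes "height T D" and "height T E"
  shows "D k - E k = D j - E j"
proof (rule const_of_step_eq[of "\<lambda>k. D k - E k"])
  fix k
  show "D k - E k = D (k - 1) - E (k - 1)"
    using height_step[OF assms(1), of k] height_step[OF assms(2), of k] by simp
qed

lemma height_shift: "height T D \<Longrightarrow> height T (\<lambda>k. D k + a)"
  unfolding height_def by simp

text \<open>Both rises, \<open>n\<close> and \<open>- m\<close>, are congruent to \<open>n\<close>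
  modulo \<open>L\<close>.\<close>

lemma height_dvd:
  assumes D: "height T D"
  shows "L dvd D k - D j - int n * (k - j)"
proof -
  have "(D k - int n * k) mod L = (D j - int n * j) mod L"
  proof (rule const_of_step_eq[of "\<lambda>k. (D k - int n * k) mod L"])
    fix k
    have *: "D k - int n * k - (D (k - 1) - int n * (k - 1)) = (if T k = North then 0 else - L)"
      using height_step[OF D, of k] by (cases "T k") (simp_all add: algebra_simps)
    then show "(D k - int n * k) mod L = (D (k - 1) - int n * (k - 1)) mod L"
      unfolding mod_eq_dvd_iff * by (simp del: minus_add_distrib)
  qed
  then show ?thesis unfolding mod_eq_dvd_iff by (simp add: algebra_simps)
qed

text \<open>The factor \<open>sqrt 2 / (m + n)\<close> in the width turns the bound
  \<open>sqrt 2\<close> into the bound \<open>L\<close> on height differences, which do not depend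
  on the additive constant.\<close>

lemma width_le_iff:
  assumes D: "height T D"
  shows "width m n T \<le> sqrt 2 \<longleftrightarrow> (\<forall>j k. D j - D k \<le> L)"
proof -
  let ?h = "\<lambda>k. int n * snd (front_path T k) - int m * fst (front_path T k)"
  let ?F = "range ?h"
  note T = height_torus_front[OF D]
  have fin: "finite ?F" and w: "width m n T = sqrt 2 / real (m + n) * real_of_int (Max ?F - Min ?F)"
    unfolding width_def
    by (rule path_width_eq[OF front_path_periodic[OF T] n_pos])+
  have "width m n T \<le> sqrt 2 \<longleftrightarrow> sqrt 2 * real_of_int (Max ?F - Min ?F) \<le> sqrt 2 * real_of_int L"
    unfolding w using L_pos n_pos by (simp add: divide_le_eq)
  also have "\<dots> \<longleftrightarrow> Max ?F - Min ?F \<le> L"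
    by (simp only: mult_le_cancel_left_pos real_sqrt_gt_0_iff zero_less_numeral of_int_le_iff)
  also have "\<dots> \<longleftrightarrow> (\<forall>j k. ?h j - ?h k \<le> L)"
  proof
    assume "Max ?F - Min ?F \<le> L"
    moreover have "?h k \<le> Max ?F" "Min ?F \<le> ?h k" for k using fin by auto
    ultimately show "\<forall>j k. ?h j - ?h k \<le> L" by (smt (verit))
  next
    assume *: "\<forall>j k. ?h j - ?h k \<le> L"
    have "Max ?F \<in> ?F" "Min ?F \<in> ?F" using fin by (auto intro!: Max_in Min_in)
    then show "Max ?F - Min ?F \<le> L" using * by (smt (verit) imageE)
  qed
  finally have "width m n T \<le> sqrt 2 \<longleftrightarrow> (\<forall>j k. ?h j - ?h k \<le> L)" .
  moreover have "?h j - ?h k = D j - D k" for j k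
    using height_unique[OF D front_height[OF T], of j k] by simp
  ultimately show ?thesis by simp
qed

section \<open>Thin fronts and their horizontal legs\<close>

definition thin :: "(int \<Rightarrow> step) \<Rightarrow> bool" where
  "thin T \<longleftrightarrow> T \<in> torus_fronts m n \<and> width m n T \<le> sqrt 2"

lemma thinD: "thin T \<Longrightarrow> height T D \<Longrightarrow> D j \<le> D k + L"
  unfolding thin_def by (auto simp: width_le_iff algebra_simps)

lemma thinI:
  assumes "height T D" and "\<And>k. a \<le> D k" and "\<And>k. D k \<le> a + L"
  shows "thin T"
proof -
  have "D j - D k \<le> L" for j k using assms(2)[of k] assms(3)[of j] by linarith
  then show ?thesis unfolding thin_def width_le_iff[OF assms(1)]
    using height_torus_front[OF assms(1)] by blast
qed

text \<open>From \<open>D (i - 1)\<close> to \<open>D j\<close> the path rises by \<open>n\<close>,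
  falls by \<open>m * (j - 1 - i)\<close> and rises by \<open>n\<close> again. The total is at most
  \<open>L\<close>, so \<open>n \<le> m * (j - i)\<close>, and \<open>m * (g - 1) < n\<close> yields
  \<open>g - 1 < j - i\<close>.\<close>

lemma thin_legs_at_least:
  assumes T: "thin T" and g: "n > m * (g - 1)"
  shows "legs_at_least g T"
  unfolding legs_at_least_def
proof (intro allI impI, elim conjE)
  fix i j :: int
  assume ij: "i < j" "T i = North" "T j = North" "\<forall>k\<in>{i<..<j}. T k = East"
  obtain D where D: "height T D" using T front_height unfolding thin_def by blast
  have run: "int l < j - i \<Longrightarrow> D (i + int l) = D i - int m * int l" for l
  proof (induction l)
    case (Suc l)
    then have "T (i + int (Suc l)) = East" using ij(4) by simp
    then show ?case using Suc height_step[OF D, of "i + int (Suc l)"] by (simp add: algebra_simps)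
  qed simp
  have "D (j - 1) = D i - int m * (j - 1 - i)" using run[of "nat (j - 1 - i)"] ij(1) by simp
  moreover have "D j = D (j - 1) + int n" "D i = D (i - 1) + int n"
    using height_step[OF D, of j] height_step[OF D, of i] ij by simp_all
  moreover have "D j \<le> D (i - 1) + L" using thinD[OF T D] .
  ultimately have "int n \<le> int m * (j - i)" by (simp add: algebra_simps)
  then have "int n \<le> int (m * nat (j - i))" using ij(1) by simp
  then have "m * (g - 1) < m * nat (j - i)" using g by linarith
  then have "g - 1 < nat (j - i)" by simp
  then show "g \<le> card {i..<j}" by simp
qed

section \<open>Balanced fronts and the cubes between them\<close>

definition res :: "int \<Rightarrow> int \<Rightarrow> int" where
  "res c k = (int n * k - c) mod L"

lemma res_nonneg: "0 \<le> res c k" and res_less: "res c k < L"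
  using L_pos by (simp_all add: res_def)

text \<open>Modulo \<open>L\<close>, subtracting \<open>n\<close> is the same as adding
  \<open>m\<close>, and exactly one of the two stays in \<open>{0..<L}\<close>. Hence
  \<open>res c\<close> moves like a height function.\<close>

lemma res_pred: "res c (k - 1) = (if int n \<le> res c k then res c k - int n else res c k + int m)"
proof -
  have "res c (k - 1) = (res c k - int n) mod L"
    unfolding res_def mod_diff_left_eq by (simp add: algebra_simps)
  also have "\<dots> = (if int n \<le> res c k then res c k - int n else res c k + int m)"
  proof (cases "int n \<le> res c k")
    case False
    have "(res c k - int n) mod L = (res c k - int n + L) mod L"
      by (rule mod_add_self2[symmetric])
    also have "res c k - int n + L = res c k + int m" by simp
    also have "(res c k + int m) mod L = res c k + int m"
      using False res_nonneg[of c k] by (intro mod_pos_pos_trivial) auto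
    finally show ?thesis using False by simp
  qed (use res_less[of c k] in auto)
  finally show ?thesis .
qed

lemma res_0_succ: "res c k = 0 \<Longrightarrow> res c (k + 1) = int n"
  using res_pred[of c "k + 1"] res_nonneg[of c "k + 1"] m_pos by (auto split: if_splits)

lemma res_0_pred: "res c k = 0 \<Longrightarrow> res c (k - 1) = int m"
  using res_pred[of c k] n_pos by simp

lemma res_periodic: "res c (k + L) = res c k"
proof -
  have "int n * (k + L) - c = int n * k - c + int n * L" by (simp add: algebra_simps)
  then show ?thesis unfolding res_def by (metis mod_mult_self1)
qed

lemma res_mod: "res c (k mod L) = res c k"
  by (rule periodic_mod) (rule res_periodic)

lemma res_eqI: "0 \<le> x \<Longrightarrow> x < L \<Longrightarrow> L dvd x - (int n * k - c) \<Longrightarrow> res c k = x"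
  unfolding res_def by (metis mod_eq_dvd_iff mod_pos_pos_trivial)

lemma res_0_iff: "res c k = 0 \<longleftrightarrow> L dvd int n * k - c"
  unfolding res_def by presburger

text \<open>The front whose heights are the residues themselves, hence confined to a half-open
  strip; as a word, a periodic mechanical (Sturmian type) word.\<close>

definition balanced :: "int \<Rightarrow> int \<Rightarrow> step" where
  "balanced c k = (if int n \<le> res c k then North else East)"

text \<open>
  The fronts with a height function congruent to \<open>n * k - c\<close> modulo \<open>L\<close> and with values in
  \<open>{0..L}\<close> (see \<open>cubeI\<close> and \<open>cube_height\<close>), described by their steps.
\<close>

definition cube :: "int \<Rightarrow> (int \<Rightarrow> step) set" where
  "cube c = {T \<in> torus_fronts m n. (\<forall>k. res c k = 0 \<longrightarrow> T k \<noteq> T (k + 1)) \<and>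
     (\<forall>k. res c k \<noteq> 0 \<and> res c (k - 1) \<noteq> 0 \<longrightarrow> T k = balanced c k)}"

definition pos :: "int \<Rightarrow> int set" where
  "pos c = {k \<in> {0..<L}. res c k = 0}"

lemma mod_in_pos: "k mod L \<in> pos c \<longleftrightarrow> res c k = 0"
  using L_pos by (simp add: pos_def res_mod)

lemma balanced_height: "height (balanced c) (res c)"
  unfolding height_def res_periodic balanced_def by (simp add: res_pred)

lemma balanced_0: "res c k = 0 \<Longrightarrow> balanced c k = East \<and> balanced c (k + 1) = North"
  using n_pos by (simp add: balanced_def res_0_succ)

lemma balanced_in_cube: "balanced c \<in> cube c"
  unfolding cube_def using height_torus_front[OF balanced_height] balanced_0 by auto

text \<open>A zero residue is preceded by height \<open>m\<close> and followed by height
  \<open>n\<close>. A northbound step leads from \<open>m\<close> to \<open>L\<close> and the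
  eastbound step after it to \<open>n\<close>; the other orientation passes through
  \<open>0\<close>.\<close>

lemma cube_height:
  assumes T: "T \<in> cube c"
  shows "height T (\<lambda>k. res c k + (if res c k = 0 \<and> T k = North then L else 0))" (is "height T ?D")
proof -
  have per: "T (k + L) = T k" for k using T by (simp add: cube_def torus_front_periodic)
  have "?D k - ?D (k - 1) = rise (T k)" for k
  proof (cases "res c k = 0")
    case True
    then show ?thesis using res_0_pred[OF True] m_pos by (cases "T k") auto
  next
    case False
    show ?thesis
    proof (cases "res c (k - 1) = 0")
      case True
      then have "T (k - 1) \<noteq> T k" using T by (auto simp: cube_def)
      then show ?thesis using True False res_0_succ[OF True]
        by (cases "T k"; cases "T (k - 1)") auto
    next
      case False': False
      then have "T k = balanced c k" using T False by (auto simp: cube_def)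
      then show ?thesis using False False' by (simp add: balanced_def res_pred)
    qed
  qed
  then show ?thesis by (simp add: height_def res_periodic per)
qed

lemma cube_thin: "T \<in> cube c \<Longrightarrow> thin T"
  by (rule thinI[OF cube_height, where a = 0]) (use res_nonneg res_less in \<open>auto simp: less_imp_le\<close>)

text \<open>Class and range leave only \<open>res c k\<close> as the height at \<open>k\<close> if
  this residue is nonzero, and \<open>0\<close> or \<open>L\<close> otherwise.\<close>

lemma cubeI:
  assumes D: "height T D" and b: "\<And>k. 0 \<le> D k" "\<And>k. D k \<le> L"
    and c: "L dvd D j - (int n * j - c)"
  shows "T \<in> cube c"
proof -
  have dv: "L dvd D k - (int n * k - c)" for k
    using dvd_add[OF c height_dvd[OF D, of k j]] by (simp add: algebra_simps)
  have nz: "D k = res c k" if "res c k \<noteq> 0" for k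
  proof -
    have "D k \<noteq> L"
    proof
      assume "D k = L"
      then have "L dvd L - (L - (int n * k - c))" using dv[of k] dvd_diff[OF dvd_refl] by metis
      then show False using that by (simp add: res_0_iff)
    qed
    then show ?thesis using b[of k] dv[of k] by (metis order_le_imp_less_or_eq res_eqI)
  qed
  have z: "D k = 0 \<or> D k = L" if "res c k = 0" for k
  proof (rule ccontr)
    assume *: "\<not> (D k = 0 \<or> D k = L)"
    then have "res c k = D k" using b[of k] dv[of k] by (intro res_eqI) (auto simp: le_less)
    then show False using that * by simp
  qed
  \<comment> \<open>At height \<open>0\<close> the bounds exclude arriving by a northbound or
    leaving by an eastbound step, and at height \<open>L\<close> the reverse.\<close>
  have "T k \<noteq> T (k + 1)" if "res c k = 0" for k
    using z[OF that] height_step[OF D, of k] height_step[OF D, of "k + 1"] b[of "k - 1"] b[of "k + 1"]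
      m_pos n_pos by (cases "T k"; cases "T (k + 1)") auto
  moreover have "T k = balanced c k" if "res c k \<noteq> 0" "res c (k - 1) \<noteq> 0" for k
    using nz[OF that(1)] nz[OF that(2)] height_step[OF D, of k] res_nonneg[of c "k - 1"]
      res_less[of c "k - 1"]
    by (cases "T k") (auto simp: balanced_def)
  ultimately show ?thesis using height_torus_front[OF D] by (simp add: cube_def)
qed

text \<open>Shift the heights so that the minimum is \<open>0\<close>. If it is attained at
  \<open>r\<close>, the offset is \<open>n * r\<close>.\<close>

lemma thin_in_cube:
  assumes T: "thin T"
  obtains r where "T \<in> cube (int n * r)"
proof -
  obtain D where D: "height T D" using T front_height unfolding thin_def by blast
  let ?J = "{0..<L}"
  have "?J \<noteq> {}" using L_pos by simp
  then obtain r where r: "\<And>k. k \<in> ?J \<Longrightarrow> D r \<le> D k"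
    using ex_min_if_finite[of "D ` ?J"] by (force simp: not_less)
  have "D r \<le> D k" for k using r[of "k mod L"] L_pos height_mod[OF D, of k] by simp
  then have "T \<in> cube (int n * r)"
    using thinD[OF T D, of _ r]
    by (intro cubeI[OF height_shift[OF D, of "- D r"], of r]) (auto simp: algebra_simps)
  then show ?thesis using that by blast
qed

section \<open>Offsets modulo \<open>L\<close>, and the faces of a cube\<close>

lemma cube_torus_front: "T \<in> cube c \<Longrightarrow> T \<in> torus_fronts m n"
  by (simp add: cube_def)

lemma cube_corner: "T \<in> cube c \<Longrightarrow> res c k = 0 \<Longrightarrow> T k \<noteq> T (k + 1)"
  by (simp add: cube_def)

lemma cube_balanced: "T \<in> cube c \<Longrightarrow> res c k \<noteq> 0 \<Longrightarrow> res c (k - 1) \<noteq> 0 \<Longrightarrow> T k = balanced c k"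
  by (simp add: cube_def)

lemma res_cong: "c mod L = c' mod L \<Longrightarrow> res c = res c'"
  unfolding res_def by (intro ext) (metis mod_diff_right_eq)

lemma balanced_cong: "c mod L = c' mod L \<Longrightarrow> balanced c = balanced c'"
  by (intro ext) (simp add: balanced_def res_cong[of c c'])

lemma pos_cong: "c mod L = c' mod L \<Longrightarrow> pos c = pos c'"
  by (simp add: pos_def res_cong[of c c'])

lemma cube_cong: "c mod L = c' mod L \<Longrightarrow> cube c = cube c'"
  by (simp add: cube_def res_cong[of c c'] balanced_cong[of c c'])

lemma pos_subset: "pos c \<subseteq> {0..<L}"
  by (auto simp: pos_def)

lemma pos_res: "k \<in> pos c \<Longrightarrow> res c k = 0"
  by (simp add: pos_def)

lemma pos_mod: "k \<in> pos c \<Longrightarrow> k mod L = k"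
  by (simp add: pos_def)

lemma torus_front_mod_succ:
  assumes "T \<in> torus_fronts m n"
  shows "T (k mod L + 1) = T (k + 1)"
  using torus_front_mod[OF assms, of "k mod L + 1"] torus_front_mod[OF assms, of "k + 1"]
  by (simp add: mod_add_left_eq)

text \<open>In a cube, the step after a position of \<open>pos c\<close> is forced by the corner
  there, and the steps away from these corners are those of \<open>balanced c\<close>. Once
  \<open>I\<close> is freed, only the orientations on \<open>pos c - I\<close> remain to be
  matched.\<close>

lemma flip_members_in_cube:
  assumes T: "T \<in> cube c" and I: "I \<subseteq> pos c"
  shows "flip_members m n T I = {S \<in> cube c. \<forall>i\<in>pos c - I. S i = T i}"
proof (intro equalityI subsetI)
  have no_pred: "res c (k - 1) \<noteq> 0" if "res c k = 0" for k
    using res_0_pred[OF that] m_pos by simp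
  have no_succ: "res c (k + 1) \<noteq> 0" if "res c k = 0" for k
    using res_0_succ[OF that] n_pos by simp
  have notin: "k mod L \<notin> I" if "res c k \<noteq> 0" for k
    using that I mod_in_pos by blast
  {
    fix S assume "S \<in> flip_members m n T I"
    then have S: "S \<in> torus_fronts m n" and corner: "\<And>i. i \<in> I \<Longrightarrow> S i \<noteq> S (i + 1)"
      and agree: "\<And>k. k mod L \<notin> I \<Longrightarrow> (k - 1) mod L \<notin> I \<Longrightarrow> S k = T k"
      unfolding flip_members_def by auto
    have "S k \<noteq> S (k + 1)" if "res c k = 0" for k
    proof (cases "k mod L \<in> I")
      case True
      then show ?thesis
        using corner[OF True] torus_front_mod[OF S, of k] torus_front_mod_succ[OF S, of k] by simp
    next
      case False
      then show ?thesis
        using agree[of k] agree[of "k + 1"] notin[OF no_pred[OF that]] notin[OF no_succ[OF that]]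
          cube_corner[OF T that] by simp
    qed
    moreover have "S k = balanced c k" if "res c k \<noteq> 0" "res c (k - 1) \<noteq> 0" for k
      using agree[of k] notin that cube_balanced[OF T] by simp
    moreover have "S i = T i" if "i \<in> pos c - I" for i
      using that agree[of i] notin[OF no_pred[OF pos_res]] pos_mod[of i c] by auto
    ultimately show "S \<in> {S \<in> cube c. \<forall>i\<in>pos c - I. S i = T i}"
      using S by (simp add: cube_def)
  }
  fix S assume "S \<in> {S \<in> cube c. \<forall>i\<in>pos c - I. S i = T i}"
  then have S: "S \<in> cube c" and agree: "\<And>i. i \<in> pos c - I \<Longrightarrow> S i = T i" by auto
  have "(S i, S (i + 1)) \<in> {(North, East), (East, North)}" if "i \<in> I" for i
    using cube_corner[OF S, of i] that I pos_res by (cases "S i"; cases "S (i + 1)") auto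
  moreover have agree': "S k = T k" if "res c k = 0" "k mod L \<notin> I" for k
    using agree[of "k mod L"] that torus_front_mod[OF cube_torus_front[OF S]]
      torus_front_mod[OF cube_torus_front[OF T]] by (simp add: mod_in_pos)
  moreover have "S k = T k" if "k mod L \<notin> I" "(k - 1) mod L \<notin> I" for k
  proof -
    consider "res c k = 0" | "res c (k - 1) = 0" | "res c k \<noteq> 0" "res c (k - 1) \<noteq> 0" by blast
    then show ?thesis
    proof cases
      \<comment> \<open>Here \<open>k\<close> is the second step of a corner, so it is opposite to
        the step at \<open>k - 1\<close>, on which \<open>S\<close> and \<open>T\<close>
        agree.\<close>
      case 2
      then show ?thesis
        using agree'[OF 2 that(2)] cube_corner[OF S 2] cube_corner[OF T 2]
          step_neq_trans[of "S k" "S (k - 1)" "T k"] by force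
    qed (use agree' that cube_balanced[OF S] cube_balanced[OF T] in auto)
  qed
  ultimately show "S \<in> flip_members m n T I"
    using cube_torus_front[OF S] by (auto simp: flip_members_def)
qed

lemma cube_eqI:
  assumes "S \<in> cube c" "T \<in> cube c" "\<And>k. k \<in> pos c \<Longrightarrow> S k = T k"
  shows "S = T"
proof -
  \<comment> \<open>With no free position, membership is agreement at every step.\<close>
  have "S \<in> flip_members m n T {}" using assms by (simp add: flip_members_in_cube)
  then show ?thesis by (auto simp: flip_members_def)
qed

lemma pos_diff:
  assumes i: "i \<in> pos c" and j: "j \<in> pos c" and "i \<noteq> j"
  shows "(i - j) mod L \<ge> 2"
proof -
  have "(i - j) mod L \<noteq> 0"
  proof
    assume "(i - j) mod L = 0"
    then have "i mod L = j mod L" by (simp add: mod_eq_dvd_iff dvd_eq_mod_eq_0)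
    then show False using assms pos_mod by metis
  qed
  moreover have "(i - j) mod L \<noteq> 1"
  proof
    assume "(i - j) mod L = 1"
    then have "((i - j) mod L + j) mod L = (j + 1) mod L" by (simp add: add.commute)
    then have "i mod L = (j + 1) mod L" by (simp add: mod_add_left_eq)
    then have "res c i = res c (j + 1)" by (metis res_mod)
    then show False using pos_res[OF i] res_0_succ[OF pos_res[OF j]] n_pos by simp
  qed
  moreover have "(i - j) mod L \<ge> 0" using L_pos by simp
  ultimately show ?thesis by linarith
qed

lemma flip_positions_pos:
  assumes "T \<in> cube c" and "I \<subseteq> pos c"
  shows "flip_positions (m + n) T I"
proof -
  have "cyclic_dist (m + n) i j \<ge> 2" if "i \<in> I" "j \<in> I" "i \<noteq> j" for i j
    using pos_diff[of i c j] pos_diff[of j c i] that assms(2) by (auto simp: cyclic_dist_def)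
  then show ?thesis
    using assms pos_subset[of c] cube_corner[OF assms(1)] pos_res unfolding flip_positions_def
    by auto
qed

lemma faces_cube:
  "flip_faces (pos c, cube c) = {(I, flip_members m n T I) | I T. I \<subseteq> pos c \<and> T \<in> cube c}"
  unfolding flip_faces_def fst_conv snd_conv
  by (intro Collect_cong ex_cong1) (auto simp: flip_members_in_cube)

section \<open>Thin flips\<close>

definition flip_at :: "int \<Rightarrow> (int \<Rightarrow> step) \<Rightarrow> int \<Rightarrow> step" where
  "flip_at i S k = (if k mod L = i then S (k + 1) else if (k - 1) mod L = i then S (k - 1) else S k)"

lemma shift_mod_neq:
  assumes "0 \<le> i" "i < L" "0 < a" "a < L"
  shows "(i - a) mod L \<noteq> i"
proof
  assume "(i - a) mod L = i"
  then have "(i - a) mod L = i mod L" using assms by simp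
  then have "L dvd i - a - i" by (simp only: mod_eq_dvd_iff)
  then have "L dvd a" by simp
  then show False using assms zdvd_not_zless by blast
qed

text \<open>Only the vertex between the two interchanged steps moves: relative to the vertex before
  the corner, its height changes between \<open>- m\<close> and \<open>n\<close>, which differ by
  \<open>L\<close>.\<close>

lemma flip_at_height:
  assumes D: "height S D" and i: "0 \<le> i" "i < L" and corner: "S i \<noteq> S (i + 1)"
  shows "height (flip_at i S) (\<lambda>k. D k + (if k mod L = i then if S i = East then L else - L else 0))"
    (is "height _ ?D")
proof -
  note S = height_torus_front[OF D]
  have pred: "(k - 1) mod L \<noteq> i" if "k mod L = i" for k
  proof -
    have "(k - 1) mod L = (i - 1) mod L" using that by (metis mod_diff_left_eq)
    moreover have "L > 1" using m_pos n_pos by simp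
    ultimately show ?thesis using shift_mod_neq[of i 1] i by simp
  qed
  have "?D k - ?D (k - 1) = rise (flip_at i S k)" for k
  proof -
    consider "k mod L = i" "(k - 1) mod L \<noteq> i" | "k mod L \<noteq> i" "(k - 1) mod L = i"
      | "k mod L \<noteq> i" "(k - 1) mod L \<noteq> i" using pred by blast
    then show ?thesis
    proof cases
      case 1
      have "S k = S i" "S (k + 1) = S (i + 1)"
        using torus_front_mod[OF S, of k] torus_front_mod_succ[OF S, of k] 1 by simp_all
      then show ?thesis using 1 corner height_step[OF D, of k]
        by (cases "S i"; cases "S (i + 1)") (simp_all add: flip_at_def)
    next
      case 2
      have "S (k - 1) = S i" "S k = S (i + 1)"
        using torus_front_mod[OF S, of "k - 1"] torus_front_mod_succ[OF S, of "k - 1"] 2 by simp_all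
      then show ?thesis using 2 corner height_step[OF D, of k]
        by (cases "S i"; cases "S (i + 1)") (simp_all add: flip_at_def)
    next
      case 3
      then show ?thesis using height_step[OF D, of k] by (simp add: flip_at_def)
    qed
  qed
  then show ?thesis using height_periodic[OF D] by (simp add: height_def)
qed

text \<open>
  If both orientations at \<open>i\<close> are thin, then the height at \<open>i\<close> has to be extremal, because the flip
  changes it by \<open>L\<close>.
\<close>

lemma thin_flip_at_in_cube:
  assumes S: "thin S" and S': "thin (flip_at i S)" and i: "0 \<le> i" "i < L" and corner: "S i \<noteq> S (i + 1)"
  shows "S \<in> cube (int n * i)"
proof -
  obtain D where D: "height S D" using S front_height unfolding thin_def by blast
  have Di: "D k = D i" if "k mod L = i" for k using height_mod[OF D, of k] that by simp
  have i': "i mod L = i" using i by simp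
  show ?thesis
  proof (cases "S i = East")
    case True
    \<comment> \<open>Flipping raises the height at \<open>i\<close> to \<open>D i + L\<close>, and
      thinness of the flipped front compares this with its unchanged heights elsewhere.\<close>
    have "D i \<le> D k" for k
    proof (cases "k mod L = i")
      case False
      then show ?thesis
        using thinD[OF S' flip_at_height[OF D i corner], of i k] True i' by simp
    qed (simp add: Di)
    then show ?thesis
      using thinD[OF S D, of _ i]
      by (intro cubeI[OF height_shift[OF D, of "- D i"], of i]) (auto simp: algebra_simps)
  next
    case False
    have "D k \<le> D i" for k
    proof (cases "k mod L = i")
      case False': False
      then show ?thesis
        using thinD[OF S' flip_at_height[OF D i corner], of k i] False i' by simp
    qed (simp add: Di)
    \<comment> \<open>The maximum \<open>D i\<close> is moved to \<open>L\<close>, which is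
      congruent to \<open>0\<close>, so the offset is again \<open>n * i\<close>.\<close>
    then show ?thesis
      using thinD[OF S D, of i]
      by (intro cubeI[OF height_shift[OF D, of "L - D i"], of i]) (auto simp: algebra_simps)
  qed
qed

text \<open>The other positions of \<open>I\<close> are at cyclic distance at least \<open>2\<close>
  from \<open>i\<close>, so their corners use neither of the two interchanged steps.\<close>

lemma flip_at_member:
  assumes S: "S \<in> flip_members m n T I" and I: "flip_positions (m + n) T I" and i: "i \<in> I"
  shows "flip_at i S \<in> flip_members m n T I"
proof -
  have range: "0 \<le> j" "j < L" "j mod L = j" if "j \<in> I" for j
    using I that unfolding flip_positions_def by auto
  have dist: "(j - k) mod L \<ge> 2" if "j \<in> I" "k \<in> I" "j \<noteq> k" for j k
    using I that unfolding flip_positions_def cyclic_dist_def by auto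
  have tf: "S \<in> torus_fronts m n" and corner: "(S j, S (j + 1)) \<in> {(North, East), (East, North)}"
    if "j \<in> I" for j
    using S that unfolding flip_members_def by auto
  have agree: "S k = T k" if "k mod L \<notin> I" "(k - 1) mod L \<notin> I" for k
    using S that unfolding flip_members_def by simp
  have L2: "L \<ge> 2" using m_pos n_pos by simp
  have ci: "S i \<noteq> S (i + 1)" using corner[OF i] by auto
  have "flip_at i S \<in> torus_fronts m n"
    using height_torus_front[OF flip_at_height[OF front_height[OF tf[OF i]] range(1,2)[OF i] ci]] .
  moreover have "(flip_at i S j, flip_at i S (j + 1)) \<in> {(North, East), (East, North)}" if j: "j \<in> I" for j
  proof (cases "j = i")
    case True
    have "(i + 1) mod L \<noteq> i"
      using shift_mod_neq[of i "L - 1"] range[OF i] L2 by (simp add: algebra_simps)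
    then show ?thesis using corner[OF i] range(3)[OF i] True by (auto simp: flip_at_def)
  next
    case False
    have "(j - 1) mod L \<noteq> i"
    proof
      assume "(j - 1) mod L = i"
      then have "(j - i) mod L = (j - (j - 1)) mod L" by (metis mod_diff_right_eq)
      then show False using dist[OF j i False] L2 by simp
    qed
    moreover have "(j + 1) mod L \<noteq> i"
    proof
      assume "(j + 1) mod L = i"
      then have "(i - j) mod L = (j + 1 - j) mod L" by (metis mod_diff_left_eq)
      then show False using dist[OF i j] False L2 by simp
    qed
    ultimately show ?thesis using corner[OF j] range(3)[OF j] False by (simp add: flip_at_def)
  qed
  moreover have "flip_at i S k = T k" if "k mod L \<notin> I" "(k - 1) mod L \<notin> I" for k
    using agree[OF that] that i by (auto simp: flip_at_def)
  ultimately show ?thesis by (simp add: flip_members_def)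
qed

text \<open>Fix \<open>i\<close> in \<open>I\<close>. Each member and its flip at \<open>i\<close>
  are thin, so all members lie in the cube with offset \<open>n * i\<close>. Flipping
  \<open>T\<close> at another \<open>j\<close> in \<open>I\<close> stays in this cube but changes
  the step at \<open>j\<close>, so \<open>j\<close> must be one of its free positions. For empty
  \<open>I\<close>, \<open>thin_in_cube\<close> applies.\<close>

lemma thin_flip_in_cube:
  assumes T: "T \<in> torus_fronts m n" and I: "flip_positions (m + n) T I"
    and thin: "\<And>S. S \<in> flip_members m n T I \<Longrightarrow> thin S"
  obtains r where "T \<in> cube (int n * r)" "I \<subseteq> pos (int n * r)"
proof (cases "I = {}")
  case True
  have "T \<in> flip_members m n T I" using T True by (simp add: flip_members_def)
  then show ?thesis using that thin thin_in_cube True by (metis empty_subsetI)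
next
  case False
  then obtain i where i: "i \<in> I" by blast
  have range: "0 \<le> j" "j < L" "j mod L = j" if "j \<in> I" for j
    using I that unfolding flip_positions_def by auto
  have corner: "T j \<noteq> T (j + 1)" if "j \<in> I" for j
    using I that unfolding flip_positions_def by auto
  have dist: "(j - k) mod L \<ge> 2" if "j \<in> I" "k \<in> I" "j \<noteq> k" for j k
    using I that unfolding flip_positions_def cyclic_dist_def by auto
  have in_cube: "S \<in> cube (int n * i)" if S: "S \<in> flip_members m n T I" for S
    using thin_flip_at_in_cube[OF thin[OF S] thin[OF flip_at_member[OF S I i]] range(1,2)[OF i]] S i
    unfolding flip_members_def by auto
  have "(T j, T (j + 1)) \<in> {(North, East), (East, North)}" if "j \<in> I" for j
    using corner[OF that] by (cases "T j"; cases "T (j + 1)") auto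
  then have T_mem: "T \<in> flip_members m n T I" using T by (simp add: flip_members_def)
  have "res (int n * i) j = 0" if j: "j \<in> I" for j
  proof (cases "j = i")
    case True
    then show ?thesis by (simp add: res_def)
  next
    case False
    let ?S = "flip_at j T"
    have L3: "L > 2"
      using dist[OF j i False] pos_mod_bound[OF L_pos, of "j - i"] by linarith
    have TC: "T \<in> cube (int n * i)" and SC: "?S \<in> cube (int n * i)"
      using in_cube T_mem flip_at_member[OF T_mem I j] by blast+
    have neq: "?S j \<noteq> T j" using corner[OF j] range[OF j] by (simp add: flip_at_def)
    \<comment> \<open>Modulo \<open>L\<close>, \<open>j\<close> differs from \<open>j - 1\<close>
      and \<open>j - 2\<close>, so the flip leaves the step at \<open>j - 1\<close> alone.\<close>
    have "(j - 1) mod L \<noteq> j" "(j - 1 - 1) mod L \<noteq> j"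
      using shift_mod_neq[of j 1] shift_mod_neq[of j 2] range[OF j] L3 by simp_all
    then have eq: "?S (j - 1) = T (j - 1)" by (simp add: flip_at_def)
    show ?thesis
    proof (rule ccontr)
      assume nz: "res (int n * i) j \<noteq> 0"
      \<comment> \<open>Two fronts of the cube can differ at \<open>j\<close> with nonzero residue
        only if \<open>j\<close> ends a corner; but then the common step at \<open>j - 1\<close>
        determines it.\<close>
      have z: "res (int n * i) (j - 1) = 0"
        using cube_balanced[OF TC nz] cube_balanced[OF SC nz] neq by metis
      show False
        using cube_corner[OF TC z] cube_corner[OF SC z] eq neq step_neq_trans[of "T j" "T (j - 1)"] by force
    qed
  qed
  then have "I \<subseteq> pos (int n * i)" using range by (auto simp: pos_def)
  then show ?thesis using that in_cube[OF T_mem] by blast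
qed

text \<open>Each thin flip lies in a cube by \<open>thin_flip_in_cube\<close>; conversely, every
  front of a cube is thin and gets the leg condition from \<open>thin_legs_at_least\<close>.\<close>

lemma Thin_eq:
  assumes g: "n > m * (g - 1)"
  shows "Thin m n g = (\<Union>r. flip_faces (pos (int n * r), cube (int n * r)))"
proof (intro equalityI subsetI)
  have fin: "finite (width m n ` flip_members m n T I)" for T I
  proof (rule finite_imageI, rule finite_subset)
    show "flip_members m n T I \<subseteq> torus_fronts m n" by (auto simp: flip_members_def)
    show "finite (torus_fronts m n)" using n_pos by (simp add: finite_torus_fronts)
  qed
  {
    fix P assume P: "P \<in> Thin m n g"
    then obtain T I where P_eq: "P = (I, flip_members m n T I)" and T: "T \<in> torus_fronts m n"
      and I: "flip_positions (m + n) T I"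
      unfolding Thin_def TF_def flips_def by blast
    have "thin S" if S: "S \<in> flip_members m n T I" for S
    proof -
      have "width m n S \<le> flip_width m n P"
        unfolding flip_width_def P_eq using fin S by (auto intro: Max_ge)
      then show ?thesis using P S by (auto simp: thin_def Thin_def flip_members_def)
    qed
    then obtain r where "T \<in> cube (int n * r)" "I \<subseteq> pos (int n * r)"
      using thin_flip_in_cube[OF T I] by blast
    then show "P \<in> (\<Union>r. flip_faces (pos (int n * r), cube (int n * r)))"
      unfolding P_eq faces_cube by blast
  }
  fix P assume "P \<in> (\<Union>r. flip_faces (pos (int n * r), cube (int n * r)))"
  then obtain c I T where P_eq: "P = (I, flip_members m n T I)" and I: "I \<subseteq> pos c" and T: "T \<in> cube c"
    unfolding faces_cube by blast
  have sub: "flip_members m n T I \<subseteq> cube c" and T_mem: "T \<in> flip_members m n T I"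
    using flip_members_in_cube[OF T I] T by auto
  have "P \<in> flips m n"
    unfolding flips_def P_eq using flip_positions_pos[OF T I] cube_torus_front[OF T] by blast
  moreover have "snd P \<subseteq> TF_vertices m n g"
    unfolding P_eq TF_vertices_def
    using sub cube_torus_front thin_legs_at_least[OF cube_thin g] by auto
  moreover have "flip_width m n P \<le> sqrt 2"
    unfolding flip_width_def P_eq snd_conv
  proof (rule Max.boundedI[OF fin])
    show "width m n ` flip_members m n T I \<noteq> {}" using T_mem by blast
    show "w \<le> sqrt 2" if "w \<in> width m n ` flip_members m n T I" for w
      using that sub cube_thin unfolding thin_def by auto
  qed
  ultimately show "P \<in> Thin m n g" by (simp add: Thin_def TF_def)
qed

section \<open>Ends and intersections of the cubes\<close>

abbreviation d :: int where "d \<equiv> int (gcd m n)"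

lemma d_pos: "d > 0"
  using m_pos by simp

lemma d_dvd: "d dvd int m" "d dvd int n" "d dvd L"
  by simp_all

lemma L_eq: "L = d * int ((m + n) div gcd m n)"
  by (metis dvd_add dvd_mult_div_cancel gcd_dvd1 gcd_dvd2 of_nat_add of_nat_mult)

text \<open>With \<open>n = d * n'\<close>, \<open>L = d * M\<close> and \<open>c = d * e\<close>,
  the congruence of \<open>n * k\<close> and \<open>c\<close> modulo \<open>L\<close> reduces to one
  modulo \<open>M\<close> in which \<open>n'\<close> is invertible, so its solutions form one class
  modulo \<open>M\<close>.\<close>

lemma pos_eq:
  assumes c: "d dvd c"
  obtains k0 where "pos c = {k \<in> {0..<L}. int ((m + n) div gcd m n) dvd k - k0}"
proof -
  define M where "M = int ((m + n) div gcd m n)"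
  have L_M: "L = d * M" unfolding M_def by (rule L_eq)
  obtain e where e: "c = d * e" using c by blast
  obtain n' where n': "int n = d * n'" using d_dvd(2) by blast
  have gcd_eq: "gcd (int n) L = d" by (metis add.commute gcd.commute gcd_add2 gcd_int_int_eq)
  then obtain u w where uw: "u * int n + w * L = d" using bezout_int by metis
  have "d * gcd n' M = d * 1"
    using gcd_eq[unfolded L_M, unfolded n'] gcd_mult_distrib_int[of d n' M] d_pos by simp
  then have cop: "coprime M n'" using d_pos m_pos by (auto simp: coprime_iff_gcd_eq_1 gcd.commute)
  have "res c k = 0 \<longleftrightarrow> M dvd k - u * e" for k
  proof -
    \<comment> \<open>Bezout's identity \<open>u * n + w * L = d\<close>, multiplied by
      \<open>e\<close>, shows that \<open>u * e\<close> is a solution.\<close>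
    have "int n * k - c = int n * (k - u * e) - L * (w * e)"
      unfolding e uw[symmetric] by (simp add: algebra_simps)
    then have "res c k = 0 \<longleftrightarrow> L dvd int n * (k - u * e)"
      unfolding res_0_iff by (simp add: dvd_diff_left_iff)
    also have "\<dots> \<longleftrightarrow> d * M dvd d * (n' * (k - u * e))"
      by (simp only: L_M[symmetric] n' mult.assoc)
    also have "\<dots> \<longleftrightarrow> M dvd n' * (k - u * e)" using m_pos by simp
    also have "\<dots> \<longleftrightarrow> M dvd k - u * e" using cop by (simp add: coprime_dvd_mult_right_iff)
    finally show ?thesis .
  qed
  then show ?thesis using that[of "u * e"] by (simp add: pos_def M_def)
qed

lemma card_pos:
  assumes c: "d dvd c"
  shows "card (pos c) = gcd m n"
proof -
  define M where "M = int ((m + n) div gcd m n)"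
  obtain k0 where k0: "pos c = {k \<in> {0..<L}. M dvd k - k0}" using pos_eq[OF c] M_def by metis
  have LM: "L = d * M" unfolding M_def by (rule L_eq)
  then have M: "M > 0" using L_pos d_pos by (simp add: zero_less_mult_iff)
  \<comment> \<open>The class of \<open>k0\<close> meets each of the \<open>d\<close> blocks of
    length \<open>M\<close> in \<open>{0..<L}\<close> once; \<open>k div M\<close> is the block
    number.\<close>
  have "bij_betw (\<lambda>j. k0 mod M + M * j) {0..<d} (pos c)"
  proof (rule bij_betwI[where g = "\<lambda>k. k div M"])
    show "(\<lambda>j. k0 mod M + M * j) \<in> {0..<d} \<rightarrow> pos c"
    proof
      fix j assume j: "j \<in> {0..<d}"
      have "M * (j + 1) \<le> M * d" using j M by (intro mult_left_mono) auto
      moreover have "M * (j + 1) = M * j + M" "M * d = L" using LM by (simp_all add: algebra_simps)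
      ultimately have "k0 mod M + M * j < L" using pos_mod_bound[OF M, of k0] by linarith
      moreover have "0 \<le> k0 mod M + M * j" using j M by simp
      moreover have "k0 mod M + M * j - k0 = M * (j - k0 div M)"
        using mult_div_mod_eq[of M k0] by (simp add: algebra_simps)
      ultimately show "k0 mod M + M * j \<in> pos c" by (simp add: k0)
    qed
    show "(\<lambda>k. k div M) \<in> pos c \<rightarrow> {0..<d}"
    proof
      fix k assume "k \<in> pos c"
      then have k: "0 \<le> k" "k < d * M" using LM by (auto simp: k0)
      have "k div M < d"
      proof (rule ccontr)
        assume "\<not> ?thesis"
        then have "d * M \<le> (k div M) * M" using M by (intro mult_right_mono) auto
        also have "\<dots> \<le> k" using div_mult_mod_eq[of k M] pos_mod_sign[OF M, of k] by linarith
        finally show False using k by simp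
      qed
      then show "k div M \<in> {0..<d}" using k M by (simp add: pos_imp_zdiv_nonneg_iff)
    qed
    show "(k0 mod M + M * j) div M = j" for j using M by simp
    show "k0 mod M + M * (k div M) = k" if "k \<in> pos c" for k
    proof -
      have "k0 mod M = k mod M" using that by (simp add: k0 mod_eq_dvd_iff dvd_diff_commute)
      then show ?thesis by simp
    qed
  qed
  then show ?thesis using bij_betw_same_card[of _ "{0..<d}" "pos c"] by force
qed

lemma pos_nonempty: "d dvd c \<Longrightarrow> pos c \<noteq> {}"
  using card_pos[of c] m_pos by auto

text \<open>Either offset has to be congruent to \<open>n * k\<close>. As a consequence, different
  cubes have disjoint position sets.\<close>

lemma res_0_unique: "res c k = 0 \<Longrightarrow> res c' k = 0 \<Longrightarrow> c mod L = c' mod L"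
  unfolding res_0_iff mod_eq_dvd_iff by (drule (1) dvd_diff) (simp add: dvd_diff_commute)

text \<open>All residues are multiples of \<open>d\<close>, so lowering them by \<open>d\<close>
  leaves the range only at \<open>0\<close>, which wraps to \<open>L - d\<close>.\<close>

lemma res_add:
  assumes c: "d dvd c"
  shows "res (c + d) k = (if res c k = 0 then L - d else res c k - d)"
proof -
  have dv: "d dvd res c k"
    unfolding res_def using c d_dvd by (intro dvd_mod dvd_diff dvd_mult2)
  have "res (c + d) k = (res c k - d) mod L"
    unfolding res_def mod_diff_left_eq by (simp add: algebra_simps)
  also have "\<dots> = (if res c k = 0 then L - d else res c k - d)"
  proof (cases "res c k = 0")
    case True
    have "(- d) mod L = (- d + L) mod L" by (rule mod_add_self2[symmetric])
    also have "\<dots> = - d + L"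
      using zdvd_imp_le[OF d_dvd(3) L_pos] d_pos by (intro mod_pos_pos_trivial) auto
    finally show ?thesis using True by simp
  next
    case False
    then have "res c k > 0" using res_nonneg[of c k] by linarith
    then have "d \<le> res c k" using dv zdvd_imp_le by blast
    then have "(res c k - d) mod L = res c k - d"
      using res_less[of c k] d_pos by (intro mod_pos_pos_trivial) auto
    then show ?thesis using False by simp
  qed
  finally show ?thesis .
qed

text \<open>The residue \<open>L - d\<close> is at least \<open>n\<close>, since
  \<open>d \<le> m\<close>, while the next residue \<open>n - d\<close> is below \<open>n\<close>.
  So these corners are opposite to those of \<open>balanced c\<close>.\<close>

lemma balanced_add_0:
  assumes c: "d dvd c" and k: "res c k = 0"
  shows "balanced (c + d) k = North \<and> balanced (c + d) (k + 1) = East"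
  using zdvd_imp_le[OF d_dvd(1)] m_pos n_pos k d_pos res_0_succ[OF k]
  by (simp add: balanced_def res_add[OF c])

lemma balanced_add_in_cube:
  assumes c: "d dvd c"
  shows "balanced (c + d) \<in> cube c"
proof -
  have "balanced (c + d) k = balanced c k" if "res c k \<noteq> 0" "res c (k - 1) \<noteq> 0" for k
  proof -
    have "d dvd res c k"
      unfolding res_def using c d_dvd by (intro dvd_mod dvd_diff dvd_mult2)
    \<comment> \<open>Among multiples of \<open>d\<close>, passing from \<open>res c k\<close> to
      \<open>res c k - d\<close> crosses the threshold \<open>n\<close> only at
      \<open>res c k = n\<close>, that is, right after a zero.\<close>
    then have "d \<le> res c k - int n" if "res c k > int n"
      using that by (intro zdvd_imp_le dvd_diff d_dvd) auto
    moreover have "res c k \<noteq> int n" using that(2) by (auto simp: res_pred)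
    ultimately show ?thesis using that(1) d_pos by (auto simp: balanced_def res_add[OF c])
  qed
  then show ?thesis
    using height_torus_front[OF balanced_height] balanced_add_0[OF c] by (auto simp: cube_def)
qed

lemma cube_constant:
  assumes c: "d dvd c" and T: "T \<in> cube c" and s: "\<And>k. k \<in> pos c \<Longrightarrow> T k = s"
  shows "T \<in> {balanced c, balanced (c + d)}"
proof (cases s)
  case North
  then have "T = balanced (c + d)"
    using s balanced_add_0[OF c] pos_res by (intro cube_eqI[OF T balanced_add_in_cube[OF c]]) auto
  then show ?thesis by simp
next
  case East
  then have "T = balanced c"
    using s balanced_0 pos_res by (intro cube_eqI[OF T balanced_in_cube]) auto
  then show ?thesis by simp
qed

text \<open>
  On \<open>pos c\<close> the height function from \<open>cube c'\<close> is constant, hence so is the one from \<open>cube c\<close>,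
  and therefore the step.
\<close>

lemma cube_Int:
  assumes c: "d dvd c" and T: "T \<in> cube c" "T \<in> cube c'" and neq: "c mod L \<noteq> c' mod L"
  shows "T \<in> {balanced c, balanced (c + d)}"
proof -
  obtain j where j: "j \<in> pos c" using pos_nonempty[OF c] by blast
  have "T k = T j" if k: "k \<in> pos c" for k
  proof -
    \<comment> \<open>Both \<open>n * k\<close> and \<open>n * j\<close> are congruent to
      \<open>c\<close>, so they have the same residue for every offset.\<close>
    have "res c' k = res c' j"
      unfolding res_def mod_eq_dvd_iff
      using pos_res[OF k] pos_res[OF j] unfolding res_0_iff
      by (drule_tac dvd_diff) (auto simp: algebra_simps)
    moreover have "res c' k \<noteq> 0" "res c' j \<noteq> 0"
      using res_0_unique pos_res[OF k] pos_res[OF j] neq by blast+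
    ultimately have "(if T k = North then L else 0) = (if T j = North then L else 0)"
      using height_unique[OF cube_height[OF T(1)] cube_height[OF T(2)], of k j]
        pos_res[OF k] pos_res[OF j] by (simp split: if_splits)
    then show ?thesis using L_pos by (cases "T k"; cases "T j") auto
  qed
  then show ?thesis by (rule cube_constant[OF c T(1)])
qed

text \<open>Both residue functions are heights of the same front, so they differ by a constant; both
  have minimum \<open>0\<close>, so the constant vanishes and a common zero fixes the
  offset.\<close>

lemma balanced_inj:
  assumes c: "d dvd c" "d dvd c'" and eq: "balanced c = balanced c'"
  shows "c mod L = c' mod L"
proof -
  obtain j where j: "res c j = 0" using pos_nonempty[OF c(1)] pos_res by blast
  obtain j' where j': "res c' j' = 0" using pos_nonempty[OF c(2)] pos_res by blast
  have "height (balanced c) (res c')" using balanced_height[of c'] eq by simp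
  then have "res c j - res c' j = res c j' - res c' j'"
    by (rule height_unique[OF balanced_height])
  then have "res c' j = 0" using j j' res_nonneg[of c' j] res_nonneg[of c j'] by linarith
  then show ?thesis using j res_0_unique by blast
qed

end

section \<open>The garland of \<open>M\<close> cubes\<close>

theorem proposition5p8:
  fixes m n g :: nat
  assumes "m > 0" and "n > 0" and "g > 0" and "n > m * (g - 1)"
  defines "M \<equiv> (m + n) div gcd m n"
  shows "\<exists>(Q :: nat \<Rightarrow> flip) (v :: nat \<Rightarrow> (int \<Rightarrow> step)).
    bij_betw Q {..<M} (maximal_cubes (Thin m n g)) \<and>
    Thin m n g = (\<Union>i<M. flip_faces (Q i)) \<and>
    (\<forall>i<M. flip_dim (Q i) = gcd m n) \<and>
    inj_on v {..<M} \<and>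
    (\<forall>i<M. diagonally_opposite (Q i) (v i) (v ((i + 1) mod M))) \<and>
    (\<forall>i<M. \<forall>j<M. i \<noteq> j \<longrightarrow>
       flip_faces (Q i) \<inter> flip_faces (Q j) =
         vertex_flip ` ({v i, v ((i + 1) mod M)} \<inter> {v j, v ((j + 1) mod M)}))"
proof -
  interpret slope m n using assms by unfold_locales
  \<comment> \<open>For \<open>i < M\<close> these are the multiples of \<open>d\<close> below
    \<open>L\<close>, so the far end \<open>balanced (c + d)\<close> of one cube is the near end of
    the next.\<close>
  define C where "C i = d * int i" for i :: nat
  define Q where "Q i = (pos (C i), cube (C i))" for i
  define v where "v i = balanced (C i)" for i
  have L_M: "L = d * int M" unfolding M_def by (rule L_eq)
  have M: "M > 0" using L_M L_pos by (cases "M = 0") auto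
  have dC: "d dvd C i" for i by (simp add: C_def)
  have C_mod: "C i mod L = C i" if "i < M" for i
    using that d_pos unfolding L_M C_def by simp
  have C_inj: "i = j" if "i < M" "j < M" "C i mod L = C j mod L" for i j
    using that C_mod m_pos by (simp add: C_def)
  have v_succ: "v ((i + 1) mod M) = balanced (C i + d)" if "i < M" for i
  proof (cases "i + 1 < M")
    case True
    then show ?thesis by (simp add: v_def C_def algebra_simps)
  next
    case False
    then have "i + 1 = M" using that by simp
    then have "int M = int i + 1" by simp
    \<comment> \<open>Adding \<open>d\<close> to the last offset gives \<open>L\<close>, congruent
      to \<open>0\<close>, which closes the cycle.\<close>
    then have "C i + d = L" unfolding L_M C_def by (simp add: algebra_simps)
    then show ?thesis using \<open>i + 1 = M\<close> by (simp add: v_def C_def balanced_cong[of 0 L])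
  qed
  have v_inj: "i = j" if "i < M" "j < M" "v i = v j" for i j
    using that C_inj balanced_inj[OF dC dC] unfolding v_def by blast
  have pos_disj: "i = j" if "i < M" "j < M" "k \<in> pos (C i)" "k \<in> pos (C j)" for i j k
    using that C_inj res_0_unique pos_res by blast
  have Thin: "Thin m n g = (\<Union>i<M. flip_faces (Q i))"
  proof -
    have to_Q: "\<exists>i<M. (pos (int n * r), cube (int n * r)) = Q i" for r
    proof -
      have "d dvd (int n * r) mod L" using d_dvd by (intro dvd_mod dvd_mult2)
      then obtain e where e: "(int n * r) mod L = d * e" by blast
      have "0 \<le> d * e" "d * e < d * int M"
        unfolding e[symmetric] L_M[symmetric] using L_pos by simp_all
      then have "0 \<le> e" "e < int M"
        using mult_le_cancel_left_pos[OF d_pos, of 0 e] mult_less_cancel_left_pos[OF d_pos, of e "int M"]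
        by simp_all
      then obtain i where i: "e = int i" "i < M" by (metis nonneg_int_cases of_nat_less_iff)
      then have "(int n * r) mod L = C i mod L" using e C_mod by (simp add: C_def)
      then show ?thesis using i pos_cong cube_cong unfolding Q_def by blast
    qed
    have of_Q: "\<exists>r. Q i = (pos (int n * r), cube (int n * r))" for i
    proof -
      \<comment> \<open>Any zero \<open>k\<close> of the cube writes its offset as
        \<open>n * k\<close> modulo \<open>L\<close>.\<close>
      obtain k where "k \<in> pos (C i)" using pos_nonempty[OF dC] by blast
      then have "res (C i) k = 0" by (rule pos_res)
      then have "C i mod L = (int n * k) mod L"
        by (rule res_0_unique) (simp add: res_def)
      then show ?thesis using pos_cong cube_cong unfolding Q_def by blast
    qed
    show ?thesis unfolding Thin_eq[OF assms(4)]
    proof (intro equalityI UN_least)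
      fix r
      show "flip_faces (pos (int n * r), cube (int n * r)) \<subseteq> (\<Union>i<M. flip_faces (Q i))"
        using to_Q[of r] by auto
    next
      fix i
      obtain r where "Q i = (pos (int n * r), cube (int n * r))" using of_Q by blast
      then show "flip_faces (Q i) \<subseteq> (\<Union>r. flip_faces (pos (int n * r), cube (int n * r)))"
        by auto
    qed
  qed
  have Q_face: "Q i \<in> flip_faces (Q i)" for i
    unfolding flip_faces_def Q_def using balanced_in_cube[of "C i"] by auto
  have Q_in_Thin: "Q i \<in> Thin m n g" if "i < M" for i
    using Thin that Q_face by blast
  have Q_maximal: "P = Q i" if i: "i < M" and P: "P \<in> Thin m n g" "Q i \<in> flip_faces P" for i P
  proof -
    obtain j where j: "j < M" "P \<in> flip_faces (Q j)" using P(1) Thin by blast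
    \<comment> \<open>The positions of \<open>P\<close> are squeezed between the nonempty sets
      \<open>pos (C i)\<close> and \<open>pos (C j)\<close>, which are disjoint unless
      \<open>i = j\<close>.\<close>
    have sub: "pos (C i) \<subseteq> fst P" "fst P \<subseteq> pos (C j)"
      using P(2) j(2) by (auto simp: flip_faces_def Q_def)
    moreover obtain k where "k \<in> pos (C i)" using pos_nonempty[OF dC] by blast
    ultimately have "i = j" using pos_disj[OF i j(1)] by blast
    then have "fst P = pos (C j)" using sub by blast
    then show ?thesis using j(2) \<open>i = j\<close> by (auto simp: flip_faces_def Q_def)
  qed
  have "maximal_cubes (Thin m n g) = Q ` {..<M}"
  proof (intro equalityI subsetI)
    fix P assume P: "P \<in> maximal_cubes (Thin m n g)"
    then obtain i where "i < M" "P \<in> flip_faces (Q i)" using Thin unfolding maximal_cubes_def by blast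
    then show "P \<in> Q ` {..<M}" using P Q_in_Thin unfolding maximal_cubes_def by blast
  next
    fix P assume "P \<in> Q ` {..<M}"
    then show "P \<in> maximal_cubes (Thin m n g)"
      unfolding maximal_cubes_def using Q_in_Thin Q_maximal by blast
  qed
  moreover have "inj_on Q {..<M}"
  proof (rule inj_onI)
    fix i j assume "i \<in> {..<M}" "j \<in> {..<M}" "Q i = Q j"
    then show "i = j" using pos_disj[of i j] pos_nonempty[OF dC, of i] by (auto simp: Q_def)
  qed
  ultimately have "bij_betw Q {..<M} (maximal_cubes (Thin m n g))" by (simp add: bij_betw_def)
  moreover have "flip_dim (Q i) = gcd m n" for i
    using card_pos[OF dC] by (simp add: flip_dim_def Q_def)
  moreover have "inj_on v {..<M}" using v_inj by (auto intro: inj_onI)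
  moreover have "diagonally_opposite (Q i) (v i) (v ((i + 1) mod M))" if "i < M" for i
    unfolding diagonally_opposite_def v_succ[OF that]
    using balanced_in_cube balanced_add_in_cube[OF dC] balanced_0 balanced_add_0[OF dC] pos_res
    by (auto simp: Q_def v_def)
  moreover have "flip_faces (Q i) \<inter> flip_faces (Q j) =
      vertex_flip ` ({v i, v ((i + 1) mod M)} \<inter> {v j, v ((j + 1) mod M)})"
    if ij: "i < M" "j < M" "i \<noteq> j" for i j
  proof -
    have vertices: "P \<in> flip_faces (Q i) \<and> fst P = {} \<longleftrightarrow> P \<in> vertex_flip ` cube (C i)" for P i
    proof -
      have "flip_members m n T {} = {T}" if "T \<in> cube (C i)" for T
        using that cube_eqI[OF _ that] by (auto simp: flip_members_in_cube)
      then show ?thesis unfolding Q_def faces_cube vertex_flip_def by (cases P) force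
    qed
    \<comment> \<open>A common face frees only positions common to both cubes, and there are
      none.\<close>
    have "fst P = {}" if "P \<in> flip_faces (Q i)" "P \<in> flip_faces (Q j)" for P
    proof -
      have "fst P \<subseteq> pos (C i)" "fst P \<subseteq> pos (C j)"
        using that by (auto simp: flip_faces_def Q_def)
      then show ?thesis using pos_disj[OF ij(1,2)] ij(3) by blast
    qed
    then have "flip_faces (Q i) \<inter> flip_faces (Q j) = vertex_flip ` cube (C i) \<inter> vertex_flip ` cube (C j)"
      using vertices by blast
    also have "\<dots> = vertex_flip ` (cube (C i) \<inter> cube (C j))"
      by (rule image_Int[symmetric]) (simp add: inj_def vertex_flip_def)
    also have "cube (C i) \<inter> cube (C j) = {v i, v ((i + 1) mod M)} \<inter> {v j, v ((j + 1) mod M)}"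
    proof -
      have neq: "C i mod L \<noteq> C j mod L" using C_inj ij by blast
      have "cube (C i) \<inter> cube (C j) \<subseteq> {balanced (C i), balanced (C i + d)}"
        using cube_Int[OF dC _ _ neq] by blast
      moreover have "cube (C i) \<inter> cube (C j) \<subseteq> {balanced (C j), balanced (C j + d)}"
        using cube_Int[OF dC _ _ neq[symmetric]] by blast
      ultimately have "cube (C i) \<inter> cube (C j)
          \<subseteq> {balanced (C i), balanced (C i + d)} \<inter> {balanced (C j), balanced (C j + d)}"
        by blast
      then show ?thesis
        unfolding v_succ[OF ij(1)] v_succ[OF ij(2)] unfolding v_def
        using balanced_in_cube balanced_add_in_cube[OF dC] by auto
    qed
    finally show ?thesis .
  qed
  ultimately show ?thesis using Thin by blast
qed

end
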